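(* Let $X$ be a complex manifold which contains an entire curve, i.e. there exists a non-constant holomorphic map $f\colon \mathbb{C}\to X$. Then, for any hermitian metric $E$ on $\mathbb{C}\times X$, the complex manifold $\mathbb{C}\times X$ is not of $E$-limit type; and, for any hermitian metric $E$ on $\mathbb{C}^{\ast}\times X$, the complex manifold $\mathbb{C}^{\ast}\times X$ is not of $E$-limit type.
   Context: Notation: $\mathbb{C}^{\ast}=\mathbb{C}\setminus\{0\}$. For a domain $\Delta\subset\mathbb{C}$ and a complex manifold $Y$, $\mathrm{Hol}(\Delta,Y)$ denotes the set of all holomorphic mappings from $\Delta$ into $Y$. For a hermitian metric $E$ on $Y$, $|\vec v|_E$ denotes the length, with respect to $E$, of a tangent vector $\vec v$ of $Y$. $E$-Brody curve: let $Y$ be a complex manifold with a hermitian metric $E$. A holomorphic curve $g\colon\mathbb{C}\to Y$ is an $E$-Brody curve if its derivative is bounded, i.e. there is a constant $c>0$ such that $|g'(z)|_E\le c$ for every $z\in\mathbb{C}$. Normal family: a family $\mathcal{F}\subset\mathrm{Hol}(\Delta,Y)$ is normal if each sequence $\{f_j\}_{j=1}^{\infty}$ in $\mathcal{F}$ has a subsequence which converges uniformly on compact subsets of $\Delta$. A family which is not normal is called non-normal. Compactly divergent sequence: a sequence $\{f_j\}_{j=1}^{\infty}$ in $\mathrm{Hol}(\Delta,Y)$ is compactly divergent if for all compact sets $K\subset\Delta$ and $L\subset Y$ there exists $j_0$ such that $f_j(K)\cap L=\emptyset$ for all $j\ge j_0$. $E$-limit type: a complex manifold $Y$ with a hermitian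 metric $E$ is of $E$-limit type if the following holds: for each domain $\Delta\subset\mathbb{C}$ and each non-normal family $\mathcal{F}\subset\mathrm{Hol}(\Delta,Y)$ such that $\mathcal{F}$ contains no compactly divergent sequence, there exist sequences $\{p_j\}\subset\Delta$ with $p_j\to p_0\in\Delta$ as $j\to\infty$, $\{f_j\}\subset\mathcal{F}$, and $\{\rho_j\}\subset\mathbb{R}$ with $\rho_j>0$ and $\rho_j\to 0^+$ as $j\to\infty$, such that $g_j(\xi):=f_j(p_j+\rho_j\xi)$, $\xi\in\mathbb{C}$, converges uniformly on any compact subset of $\mathbb{C}$ to a non-constant $E$-Brody curve $g\colon\mathbb{C}\to Y$. (On a given compact subset of $\mathbb{C}$, $g_j$ is defined for all sufficiently large $j$.) *)

theory Defs
  imports "HOL-Analysis.Analysis"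
begin

text \<open>A chart is a pair of a coordinate domain and a coordinate map; the values of the coordinate map
  outside the coordinate domain are irrelevant. A manifold is a topology together with a
  (not necessarily maximal) holomorphic atlas; connectedness is not required.\<close>

type_synonym ('a, 'n) chart = "'a set \<times> ('a \<Rightarrow> complex ^ 'n)"

definition holomorphic_map_on ::
  "(complex ^ 'n \<Rightarrow> complex ^ 'm) \<Rightarrow> (complex ^ 'n) set \<Rightarrow> bool" where
  "holomorphic_map_on f V \<longleftrightarrow>
     open V \<and> (\<forall>x\<in>V. \<exists>M :: complex ^ 'n ^ 'm. (f has_derivative (\<lambda>v. M *v v)) (at x))"

definition transition ::
  "('a, 'n::finite) chart \<Rightarrow> ('a, 'm::finite) chart \<Rightarrow> complex ^ 'n \<Rightarrow> complex ^ 'm" where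
  "transition c c' = snd c' \<circ> inv_into (fst c) (snd c)"

definition complex_manifold :: "'a topology \<Rightarrow> ('a, 'n::finite) chart set \<Rightarrow> bool" where
  "complex_manifold X A \<longleftrightarrow>
     Hausdorff_space X \<and> second_countable X \<and>
     (\<Union>c\<in>A. fst c) = topspace X \<and>
     (\<forall>(U, \<phi>)\<in>A. openin X U \<and> open (\<phi> ` U) \<and>
        homeomorphic_map (subtopology X U) (top_of_set (\<phi> ` U)) \<phi>) \<and>
     (\<forall>c\<in>A. \<forall>c'\<in>A. holomorphic_map_on (transition c c') (snd c ` (fst c \<inter> fst c')))"

definition plane_atlas :: "complex set \<Rightarrow> (complex, 1) chart set" where
  "plane_atlas S = {(S, vec)}"

definition prod_chart ::
  "('a, 'm::finite) chart \<Rightarrow> ('b, 'n::finite) chart \<Rightarrow> ('a \<times> 'b, 'm + 'n) chart" where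
  "prod_chart c c' = (fst c \<times> fst c',
     \<lambda>(x, y). \<chi> k. case k of Inl i \<Rightarrow> snd c x $ i | Inr j \<Rightarrow> snd c' y $ j)"

definition prod_atlas ::
  "('a, 'm::finite) chart set \<Rightarrow> ('b, 'n::finite) chart set \<Rightarrow> ('a \<times> 'b, 'm + 'n) chart set" where
  "prod_atlas A B = {prod_chart c c' |c c'. c \<in> A \<and> c' \<in> B}"

definition charts_at :: "('a, 'n::finite) chart set \<Rightarrow> 'a \<Rightarrow> ('a, 'n) chart set" where
  "charts_at A p = {c \<in> A. p \<in> fst c}"

text \<open>A (holomorphic) tangent vector at \<open>p\<close> is the family of its coordinate vectors with respect to
  all charts around \<open>p\<close>, related by the derivatives of the transition maps. It is set to \<open>0\<close> at
  all other charts, so that the tangent space is a linear subspace of a function space, with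
  pointwise operations.\<close>

type_synonym ('a, 'n) tvec = "('a, 'n) chart \<Rightarrow> complex ^ 'n"

definition tangent_space :: "('a, 'n::finite) chart set \<Rightarrow> 'a \<Rightarrow> ('a, 'n) tvec set" where
  "tangent_space A p = {v.
     (\<forall>c. c \<notin> charts_at A p \<longrightarrow> v c = 0) \<and>
     (\<forall>c\<in>charts_at A p. \<forall>c'\<in>charts_at A p.
        v c' = frechet_derivative (transition c c') (at (snd c p)) (v c))}"

text \<open>The tangent vector at \<open>p\<close> with coordinate vector \<open>x\<close> in the chart \<open>c\<close>.\<close>

definition tangent_of_coords ::
  "('a, 'n::finite) chart set \<Rightarrow> ('a, 'n) chart \<Rightarrow> 'a \<Rightarrow> complex ^ 'n \<Rightarrow> ('a, 'n) tvec" where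
  "tangent_of_coords A c p x = (\<lambda>c'. if c' \<in> charts_at A p
     then frechet_derivative (transition c c') (at (snd c p)) x else 0)"

text \<open>Class \<open>C\<^sup>k\<close> in the real sense; only meaningful for open \<open>V\<close>.\<close>

primrec Ck_on ::
  "nat \<Rightarrow> ('v::real_normed_vector \<Rightarrow> 'w::real_normed_vector) \<Rightarrow> 'v set \<Rightarrow> bool" where
  "Ck_on 0 f V \<longleftrightarrow> continuous_on V f"
| "Ck_on (Suc k) f V \<longleftrightarrow> (\<forall>x\<in>V. f differentiable (at x)) \<and>
     (\<forall>v. Ck_on k (\<lambda>x. frechet_derivative f (at x) v) V)"

text \<open>\<open>E p\<close> is a hermitian inner product on the tangent space at \<open>p\<close>, linear in the first and
  antilinear in the second argument, and its Gram matrix with respect to the coordinate frame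
  of every chart is smooth. The values of \<open>E\<close> off the tangent spaces are irrelevant.\<close>

definition hermitian_metric ::
  "'a topology \<Rightarrow> ('a, 'n::finite) chart set \<Rightarrow> ('a \<Rightarrow> ('a, 'n) tvec \<Rightarrow> ('a, 'n) tvec \<Rightarrow> complex) \<Rightarrow> bool"
where
  "hermitian_metric X A E \<longleftrightarrow>
     (\<forall>p\<in>topspace X.
        (\<forall>u\<in>tangent_space A p. \<forall>v\<in>tangent_space A p. \<forall>w\<in>tangent_space A p.
           E p (\<lambda>c. u c + v c) w = E p u w + E p v w) \<and>
        (\<forall>a. \<forall>v\<in>tangent_space A p. \<forall>w\<in>tangent_space A p. E p (\<lambda>c. a *s v c) w = a * E p v w) \<and>
        (\<forall>v\<in>tangent_space A p. \<forall>w\<in>tangent_space A p. E p w v = cnj (E p v w)) \<and>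
        (\<forall>v\<in>tangent_space A p. v \<noteq> (\<lambda>c. 0) \<longrightarrow> Re (E p v v) > 0)) \<and>
     (\<forall>c\<in>A. \<forall>i j k. Ck_on k
        (\<lambda>x. let p = inv_into (fst c) (snd c) x in
           E p (tangent_of_coords A c p (axis i 1)) (tangent_of_coords A c p (axis j 1)))
        (snd c ` fst c))"

definition tlength ::
  "('a \<Rightarrow> ('a, 'n::finite) tvec \<Rightarrow> ('a, 'n) tvec \<Rightarrow> complex) \<Rightarrow> 'a \<Rightarrow> ('a, 'n) tvec \<Rightarrow> real" where
  "tlength E p v = sqrt (Re (E p v v))"

text \<open>A holomorphic map on \<open>\<Delta>\<close> is represented by a total function whose values outside \<open>\<Delta>\<close> are
  irrelevant: the notions below depend only on the restrictions to \<open>\<Delta>\<close>.\<close>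

definition Hol :: "complex set \<Rightarrow> 'a topology \<Rightarrow> ('a, 'n::finite) chart set \<Rightarrow> (complex \<Rightarrow> 'a) set" where
  "Hol \<Delta> X A = {f. continuous_map (top_of_set \<Delta>) X f \<and>
     (\<forall>c\<in>A. \<forall>i. (\<lambda>z. snd c (f z) $ i) holomorphic_on {z \<in> \<Delta>. f z \<in> fst c})}"

definition curve_deriv ::
  "('a, 'n::finite) chart set \<Rightarrow> (complex \<Rightarrow> 'a) \<Rightarrow> complex \<Rightarrow> ('a, 'n) tvec" where
  "curve_deriv A g z = (\<lambda>c. if c \<in> charts_at A (g z)
     then (\<chi> i. deriv (\<lambda>w. snd c (g w) $ i) z) else 0)"

definition brody_curve ::
  "'a topology \<Rightarrow> ('a, 'n::finite) chart set \<Rightarrow> ('a \<Rightarrow> ('a, 'n) tvec \<Rightarrow> ('a, 'n) tvec \<Rightarrow> complex) \<Rightarrow>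
   (complex \<Rightarrow> 'a) \<Rightarrow> bool" where
  "brody_curve X A E g \<longleftrightarrow>
     g \<in> Hol UNIV X A \<and> (\<exists>C>0. \<forall>z. tlength E (g z) (curve_deriv A g z) \<le> C)"

text \<open>Uniform convergence refers to a distance inducing the topology. For continuous maps it does
  not depend on the choice of this distance, being convergence in the compact-open topology.
  Only finitely many \<open>f j\<close> may fail to map a given compact set into \<open>X\<close>.\<close>

definition conv_unif_on_compacts ::
  "complex set \<Rightarrow> 'a topology \<Rightarrow> (nat \<Rightarrow> complex \<Rightarrow> 'a) \<Rightarrow> (complex \<Rightarrow> 'a) \<Rightarrow> bool" where
  "conv_unif_on_compacts \<Delta> X f g \<longleftrightarrow> g ` \<Delta> \<subseteq> topspace X \<and>
     (\<exists>d. Metric_space (topspace X) d \<and> Metric_space.mtopology (topspace X) d = X \<and>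
        (\<forall>K. compact K \<and> K \<subseteq> \<Delta> \<longrightarrow> (\<forall>\<epsilon>>0. \<forall>\<^sub>F j in sequentially. \<forall>z\<in>K.
           f j z \<in> topspace X \<and> d (f j z) (g z) < \<epsilon>)))"

definition normal_family :: "complex set \<Rightarrow> 'a topology \<Rightarrow> (complex \<Rightarrow> 'a) set \<Rightarrow> bool" where
  "normal_family \<Delta> X F \<longleftrightarrow> (\<forall>f :: nat \<Rightarrow> complex \<Rightarrow> 'a. range f \<subseteq> F \<longrightarrow>
     (\<exists>r g. strict_mono (r :: nat \<Rightarrow> nat) \<and> conv_unif_on_compacts \<Delta> X (f \<circ> r) g))"

definition compactly_divergent ::
  "complex set \<Rightarrow> 'a topology \<Rightarrow> (nat \<Rightarrow> complex \<Rightarrow> 'a) \<Rightarrow> bool" where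
  "compactly_divergent \<Delta> X f \<longleftrightarrow>
     (\<forall>K L. compact K \<and> K \<subseteq> \<Delta> \<and> compactin X L \<longrightarrow> (\<exists>j0. \<forall>j\<ge>j0. f j ` K \<inter> L = {}))"

definition limit_type ::
  "'a topology \<Rightarrow> ('a, 'n::finite) chart set \<Rightarrow> ('a \<Rightarrow> ('a, 'n) tvec \<Rightarrow> ('a, 'n) tvec \<Rightarrow> complex) \<Rightarrow> bool"
where
  "limit_type X A E \<longleftrightarrow>
     (\<forall>\<Delta> F. open \<Delta> \<and> connected \<Delta> \<and> \<Delta> \<noteq> {} \<and> F \<subseteq> Hol \<Delta> X A \<and> \<not> normal_family \<Delta> X F \<and>
        \<not> (\<exists>f. range f \<subseteq> F \<and> compactly_divergent \<Delta> X f) \<longrightarrow>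
        (\<exists>p p0 f \<rho> g. range p \<subseteq> \<Delta> \<and> p0 \<in> \<Delta> \<and> p \<longlonglongrightarrow> p0 \<and> range f \<subseteq> F \<and>
           (\<forall>j. \<rho> j > 0) \<and> \<rho> \<longlonglongrightarrow> (0::real) \<and>
           conv_unif_on_compacts UNIV X (\<lambda>j \<xi>. f j (p j + of_real (\<rho> j) * \<xi>)) g \<and>
           brody_curve X A E g \<and> \<not> g constant_on UNIV))"

end

(* A family of reparametrizations z -> (theta(n z), f(h(theta(n z)))) of one entire curve
   (theta = id for the plane, theta = exp for the punctured plane), taken through a fixed point,
   is not normal and contains no compactly divergent sequence. Every limit of rescalings is again
   the same curve after a change of parameter theta(a + b xi) with b >= 0, because its first
   component determines the second. Choosing the entire function h so that h(k) = z0, with f'(z0) nonzero,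
   and h'(k) so large that it beats the given metric at the point (k, f(z0)),
   makes all nonconstant ones of these limits fail to be Brody. *)
theory Submission
  imports Defs "HOL-Complex_Analysis.Cauchy_Integral_Formula"
begin

text \<open>The obstacle is that the metric is arbitrary: it need not be complete, nor comparable to
  a product metric, so nothing is known about its growth. It is therefore tested only at the
  countably many points \<open>(of_nat k, f z\<^sub>0)\<close>. At each of them it turns into one
  real threshold for the derivative of \<open>h\<close> at \<open>k\<close>, and an entire function
  can meet countably many such demands at once. A second difficulty is the order of choices. The
  slope \<open>b\<close> of the limit curve and its Brody constant \<open>C\<close> appear only
  after \<open>h\<close> has been fixed. So the length to be forced at the k-th point is
  \<open>k\<close> times the horizontal speed, which is at least \<open>b\<close>: a bound
  homogeneous in the unknown speed, with a factor that finally exceeds \<open>C / b\<close> whatever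
  \<open>b > 0\<close> is. The graph over the planar factor removes any need to understand curves in
  \<open>X\<close>: only limits of \<theta> along affine reparametrizations have to be
  identified.\<close>

section \<open>Entire functions with prescribed values and large derivatives at the positive
  integers\<close>

text \<open>The sum over j of (2u/j)^(m j) works: at u = k all terms are nonnegative reals, and the
  k-th alone is 2^(m k), which exceeds \<open>N k\<close> for a suitable exponent. Exponents with m
  j >= j make the series converge locally uniformly.\<close>

lemma entire_dominating_sequence:
  fixes N :: "nat \<Rightarrow> real"
  obtains q and r :: "nat \<Rightarrow> real" where "q holomorphic_on UNIV"
    and "\<And>k. k > 0 \<Longrightarrow> q (of_nat k) = of_real (r k)" and "\<And>k. k > 0 \<Longrightarrow> r k \<ge> N k"
proof -
  have "\<exists>m. m \<ge> k \<and> 2 ^ m \<ge> N k" for k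
  proof -
    obtain m where "N k < 2 ^ m" using real_arch_pow[of 2 "N k"] by auto
    moreover have "(2::real) ^ m \<le> 2 ^ (max m k)" by (rule power_increasing) auto
    ultimately have "N k \<le> 2 ^ max m k" by linarith
    then show ?thesis by (intro exI[of _ "max m k"]) auto
  qed
  then obtain m where m: "\<And>k. m k \<ge> k" "\<And>k. 2 ^ m k \<ge> N k" by metis
  \<comment> \<open>Division by zero yields 0, so the term with index 0 is a constant, 0 or 1, and
    keeps the series entire with nonnegative values at the integers.\<close>
  define t where "t = (\<lambda>j (u::complex). (2 * u / of_nat j) ^ m j)"
  have bd: "\<exists>d h. 0 < d \<and> summable (h :: nat \<Rightarrow> complex) \<and> range h \<subseteq> \<real>\<^sub>\<ge>\<^sub>0 \<and>
      (\<forall>\<^sub>F n in sequentially. \<forall>y\<in>ball x d \<inter> UNIV. norm (t n y) \<le> norm (h n))" for x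
  proof (intro exI[of _ 1] exI[of _ "\<lambda>n. of_real ((1/2)^n)"] conjI)
    show "summable (\<lambda>n. complex_of_real ((1/2)^n))"
      by (intro summable_of_real summable_geometric) auto
    show "range (\<lambda>n. complex_of_real ((1/2)^n)) \<subseteq> \<real>\<^sub>\<ge>\<^sub>0" by auto
    show "\<forall>\<^sub>F n in sequentially. \<forall>y\<in>ball x 1 \<inter> UNIV. norm (t n y) \<le> norm (complex_of_real ((1/2)^n))"
    \<comment> \<open>From n >= 4(|x| + 1) on, |2y/n| <= 1/2 throughout the unit ball around x, so
      the terms lie below the geometric series of ratio 1/2; the extra 1 makes n positive.\<close>
    proof (rule eventually_sequentiallyI[of "nat \<lceil>4 * (norm x + 1)\<rceil> + 1"], safe)
      fix n y assume n: "nat \<lceil>4 * (norm x + 1)\<rceil> + 1 \<le> n" and y: "y \<in> ball x 1"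
      have "norm y \<le> norm x + 1"
        using y norm_triangle_ineq2[of y x] by (simp add: dist_norm norm_minus_commute)
      moreover have "4 * (norm x + 1) \<le> real n" "n > 0" using n by linarith+
      ultimately have "norm (2 * y / of_nat n) \<le> 1/2"
        by (simp add: norm_divide norm_mult field_simps)
      then have "norm (t n y) \<le> (1/2) ^ m n"
        unfolding t_def norm_power by (rule power_mono) auto
      also have "\<dots> \<le> (1/2) ^ n" by (rule power_decreasing) (use m in auto)
      finally show "norm (t n y) \<le> norm (complex_of_real ((1/2)^n))"
        by (simp add: norm_power norm_divide)
    qed
  qed auto
  have "t n field_differentiable at x" for n x
    by (rule holomorphic_on_imp_differentiable_at[of _ UNIV])
      (auto simp: t_def divide_inverse intro!: holomorphic_intros)
  then obtain q where q: "\<And>x. (\<lambda>n. t n x) sums q x \<and> q field_differentiable at x"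
    by (rule series_differentiable_comparison_complex[of UNIV t, OF open_UNIV _ bd]) auto
  define r where "r = (\<lambda>k. \<Sum>n. (2 * real k / real n) ^ m n)"
  have *: "summable (\<lambda>n. (2 * real k / real n) ^ m n)" "q (of_nat k) = of_real (r k)" for k
  proof -
    have e: "t n (of_nat k) = of_real ((2 * real k / real n) ^ m n)" for n
      by (simp add: t_def)
    have "(\<lambda>n. complex_of_real ((2 * real k / real n) ^ m n)) sums q (of_nat k)"
      using q[of "of_nat k"] by (simp only: e)
    moreover from this show s: "summable (\<lambda>n. (2 * real k / real n) ^ m n)"
      using sums_summable summable_complex_of_real by blast
    then have "(\<lambda>n. complex_of_real ((2 * real k / real n) ^ m n)) sums of_real (r k)"
      unfolding r_def by (intro sums_of_real summable_sums)
    ultimately show "q (of_nat k) = of_real (r k)" using sums_unique2 by blast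
  qed
  show thesis
  proof
    show "q holomorphic_on UNIV"
      using q by (auto simp: holomorphic_on_def field_differentiable_at_within)
    show "q (of_nat k) = of_real (r k)" for k by (rule *)
    show "r k \<ge> N k" if "k > 0" for k
    proof -
      have "N k \<le> (2 * real k / real k) ^ m k" using m that by simp
      also have "\<dots> = (\<Sum>n\<in>{k}. (2 * real k / real n) ^ m n)" by simp
      also have "\<dots> \<le> r k" unfolding r_def by (rule sum_le_suminf) (auto simp: *)
      finally show ?thesis .
    qed
  qed
qed

text \<open>The function sin(2 pi u) vanishes at the integers with derivative 2 pi there.
  Multiplying it by \<open>q\<close> thus fixes the value \<open>z\<^sub>0\<close> and turns the
  size of \<open>q\<close> at k into the size of the derivative.\<close>

lemma entire_interpolation:
  fixes N :: "nat \<Rightarrow> real" and z\<^sub>0 :: complex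
  obtains h and r :: "nat \<Rightarrow> real" where "h holomorphic_on UNIV"
    and "\<And>k. k > 0 \<Longrightarrow> h (of_nat k) = z\<^sub>0"
    and "\<And>k. k > 0 \<Longrightarrow> (h has_field_derivative of_real (r k)) (at (of_nat k))"
    and "\<And>k. k > 0 \<Longrightarrow> r k \<ge> N k"
proof -
  obtain q r where q: "q holomorphic_on UNIV"
    and r: "\<And>k. k > 0 \<Longrightarrow> q (of_nat k) = of_real (r k)" "\<And>k. k > 0 \<Longrightarrow> r k \<ge> \<bar>N k\<bar>"
    \<comment> \<open>The absolute value makes \<open>r k\<close> nonnegative, so that the factor 2
      pi can only enlarge it.\<close>
    using entire_dominating_sequence[of "\<lambda>k. \<bar>N k\<bar>"] by blast
  define h where "h = (\<lambda>u. z\<^sub>0 + sin (of_real (2 * pi) * u) * q u)"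
  have s: "sin (of_real (2 * pi) * of_nat k) = (0::complex)"
    and c: "cos (of_real (2 * pi) * of_nat k) = (1::complex)" for k
  proof -
    have "complex_of_real (2 * pi) * of_nat k = of_real (2 * pi * real k)" by simp
    moreover have "sin (2 * pi * real k) = 0" "cos (2 * pi * real k) = 1"
      using sin_npi2[of "2*k"] cos_npi2[of "2*k"] by (simp_all add: mult_ac)
    ultimately show "sin (of_real (2 * pi) * of_nat k) = (0::complex)"
      "cos (of_real (2 * pi) * of_nat k) = (1::complex)"
      by (simp_all only: sin_of_real cos_of_real of_real_0 of_real_1)
  qed
  show thesis
  proof
    show "h holomorphic_on UNIV" unfolding h_def by (intro holomorphic_intros q)
    show "h (of_nat k) = z\<^sub>0" for k unfolding h_def using s by simp
    show "(h has_field_derivative of_real (2 * pi * r k)) (at (of_nat k))" if "k > 0" for k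
    proof -
      have "(q has_field_derivative deriv q (of_nat k)) (at (of_nat k))"
        using holomorphic_derivI[OF q open_UNIV UNIV_I] .
      then have "(h has_field_derivative (cos (of_real (2 * pi) * of_nat k) * of_real (2*pi) * q (of_nat k)
          + deriv q (of_nat k) * sin (of_real (2 * pi) * of_nat k))) (at (of_nat k))"
        unfolding h_def by (auto intro!: derivative_eq_intros)
      then show ?thesis using r(1)[OF that] by (simp only: s c) simp
    qed
    show "2 * pi * r k \<ge> N k" if "k > 0" for k
    proof -
      have "1 * r k \<le> 2 * pi * r k" using r(2)[OF that] pi_gt3 by (intro mult_right_mono) auto
      then show ?thesis using r(2)[OF that] by linarith
    qed
  qed
qed

section \<open>Tangent spaces and lower bounds for lengths\<close>

lemma scaleR_eq_vector_scalar:
  "complex_of_real r *s v = r *\<^sub>R (v :: complex ^ 'n)"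
  unfolding vec_eq_iff vector_scalar_mult_def vector_scaleR_component by (simp add: scaleR_conv_of_real[of r "v $ i" for i])

lemma tangent_spaceI:
  assumes "\<And>c. c \<notin> charts_at A p \<Longrightarrow> v c = 0"
    and "\<And>c c'. c \<in> charts_at A p \<Longrightarrow> c' \<in> charts_at A p \<Longrightarrow>
      v c' = frechet_derivative (transition c c') (at (snd c p)) (v c)"
  shows "v \<in> tangent_space A p"
  using assms unfolding tangent_space_def by blast

lemma tangent_spaceD:
  assumes "v \<in> tangent_space A p"
  shows "c \<notin> charts_at A p \<Longrightarrow> v c = 0"
    and "c \<in> charts_at A p \<Longrightarrow> c' \<in> charts_at A p \<Longrightarrow>
      v c' = frechet_derivative (transition c c') (at (snd c p)) (v c)"
  using assms unfolding tangent_space_def by blast+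

lemma tangent_space_add:
  assumes "\<And>c c'. c \<in> charts_at A p \<Longrightarrow> c' \<in> charts_at A p \<Longrightarrow> transition c c' differentiable (at (snd c p))"
    and "u \<in> tangent_space A p" "v \<in> tangent_space A p"
  shows "(\<lambda>c. u c + v c) \<in> tangent_space A p"
proof (rule tangent_spaceI)
  fix c c' assume c: "c \<in> charts_at A p" "c' \<in> charts_at A p"
  show "u c' + v c' = frechet_derivative (transition c c') (at (snd c p)) (u c + v c)"
    unfolding linear_add[OF linear_frechet_derivative[OF assms(1)[OF c]]]
      tangent_spaceD(2)[OF assms(2) c, symmetric] tangent_spaceD(2)[OF assms(3) c, symmetric] ..
qed (simp add: tangent_spaceD(1)[OF assms(2)] tangent_spaceD(1)[OF assms(3)])

text \<open>Real factors are the natural ones here: mere differentiability of the transitions gives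
  real linearity of their derivatives, and the speeds and derivatives compared later are all
  real.\<close>

lemma tangent_space_scale_real:
  assumes "\<And>c c'. c \<in> charts_at A p \<Longrightarrow> c' \<in> charts_at A p \<Longrightarrow> transition c c' differentiable (at (snd c p))"
    and "v \<in> tangent_space A p"
  shows "(\<lambda>c. complex_of_real r *s v c) \<in> tangent_space A p"
  unfolding scaleR_eq_vector_scalar
proof (rule tangent_spaceI)
  fix c c' assume c: "c \<in> charts_at A p" "c' \<in> charts_at A p"
  show "r *\<^sub>R v c' = frechet_derivative (transition c c') (at (snd c p)) (r *\<^sub>R v c)"
    unfolding linear_scale[OF linear_frechet_derivative[OF assms(1)[OF c]]]
      tangent_spaceD(2)[OF assms(2) c, symmetric] ..
qed (simp add: tangent_spaceD(1)[OF assms(2)])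

text \<open>The squared length of u + M v is a quadratic polynomial in M whose leading coefficient,
  the squared length of v, is positive. The factor l comes out by homogeneity, so one threshold N
  serves every l; this matters because l is still unknown when N is used.\<close>

lemma tlength_lower_bound:
  fixes K :: real
  assumes E: "hermitian_metric X A E" and p: "p \<in> topspace X"
    and tr: "\<And>c c'. c \<in> charts_at A p \<Longrightarrow> c' \<in> charts_at A p \<Longrightarrow> transition c c' differentiable (at (snd c p))"
    and u: "u \<in> tangent_space A p" and v: "v \<in> tangent_space A p" "v \<noteq> (\<lambda>c. 0)"
  shows "\<exists>N. \<forall>M\<ge>N. \<forall>l\<ge>0. tlength E p (\<lambda>c. complex_of_real l *s (u c + complex_of_real M *s v c)) \<ge> l * K"
proof -
  note add = tangent_space_add[OF tr] and scale = tangent_space_scale_real[OF tr]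
  have lin: "\<And>u v w. u \<in> tangent_space A p \<Longrightarrow> v \<in> tangent_space A p \<Longrightarrow> w \<in> tangent_space A p \<Longrightarrow>
            E p (\<lambda>c. u c + v c) w = E p u w + E p v w"
    and sc: "\<And>a v w. v \<in> tangent_space A p \<Longrightarrow> w \<in> tangent_space A p \<Longrightarrow> E p (\<lambda>c. a *s v c) w = a * E p v w"
    and herm: "\<And>v w. v \<in> tangent_space A p \<Longrightarrow> w \<in> tangent_space A p \<Longrightarrow> E p w v = cnj (E p v w)"
    and pos: "Re (E p v v) > 0"
    using E p v unfolding hermitian_metric_def by blast+
  define a b e where "a = Re (E p u u)" and "b = Re (E p u v)" and "e = Re (E p v v)"
  have e: "e > 0" using pos by (simp add: e_def)
  have norm2: "Re (E p (\<lambda>c. u c + complex_of_real M *s v c) (\<lambda>c. u c + complex_of_real M *s v c))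
      = a + 2 * M * b + M\<^sup>2 * e" for M
  proof -
    let ?w = "\<lambda>c. u c + complex_of_real M *s v c"
    have Mv: "(\<lambda>c. complex_of_real M *s v c) \<in> tangent_space A p" by (rule scale) (use v in auto)
    have w: "?w \<in> tangent_space A p" by (rule add) (use u Mv in auto)
    have wx: "E p ?w x = E p u x + of_real M * E p v x" if "x \<in> tangent_space A p" for x
      using lin[OF u Mv that] sc[OF v(1) that] by simp
    have "E p ?w ?w = E p u ?w + of_real M * E p v ?w" by (rule wx[OF w])
    also have "E p u ?w = cnj (E p u u + of_real M * E p v u)"
      using herm[OF w u] wx[OF u] by simp
    also have "E p v ?w = cnj (E p u v + of_real M * E p v v)"
      using herm[OF w v(1)] wx[OF v(1)] by simp
    also have "E p v u = cnj (E p u v)" by (rule herm[OF u v(1)])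
    finally show ?thesis by (simp add: a_def b_def e_def power2_eq_square algebra_simps)
  qed
  \<comment> \<open>The threshold gives both M >= 1 and M e - 2|b| - |a| >= K^2. Multiplying the
    second by M keeps it above K^2, and the product is at most a + 2 M b + M^2 e.\<close>
  have main: "l * K \<le> tlength E p (\<lambda>c. complex_of_real l *s (u c + complex_of_real M *s v c))"
    if M: "M \<ge> 1 + (K\<^sup>2 + 2 * \<bar>b\<bar> + \<bar>a\<bar>) / e" and l: "l \<ge> 0" for M l
  proof -
    let ?w = "\<lambda>c. u c + complex_of_real M *s v c"
    have Mv: "(\<lambda>c. complex_of_real M *s v c) \<in> tangent_space A p" by (rule scale) (use v in auto)
    have w: "?w \<in> tangent_space A p" by (rule add) (use u Mv in auto)
    have lw: "(\<lambda>c. complex_of_real l *s ?w c) \<in> tangent_space A p" by (rule scale) (use w in auto)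
    have "(K\<^sup>2 + 2 * \<bar>b\<bar> + \<bar>a\<bar>) / e \<ge> 0" using e by simp
    then have M1: "M \<ge> 1" using M by linarith
    have "(K\<^sup>2 + 2 * \<bar>b\<bar> + \<bar>a\<bar>) / e \<le> M" using M by linarith
    then have "K\<^sup>2 \<le> M * e - 2 * \<bar>b\<bar> - \<bar>a\<bar>" using e by (simp add: field_simps)
    also have "\<dots> \<le> M * (M * e - 2 * \<bar>b\<bar> - \<bar>a\<bar>)"
      using mult_right_mono[OF M1, of "M * e - 2 * \<bar>b\<bar> - \<bar>a\<bar>"] calculation zero_le_power2[of K]
      by simp
    also have "\<dots> \<le> a + 2 * M * b + M\<^sup>2 * e"
    proof -
      have "M * (- \<bar>b\<bar>) \<le> M * b" "1 * \<bar>a\<bar> \<le> M * \<bar>a\<bar>"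
        using M1 by (intro mult_left_mono mult_right_mono; simp)+
      then show ?thesis by (simp add: power2_eq_square algebra_simps)
    qed
    finally have K: "K\<^sup>2 \<le> Re (E p ?w ?w)" unfolding norm2 .
    have "E p (\<lambda>c. complex_of_real l *s ?w c) (\<lambda>c. complex_of_real l *s ?w c) = of_real (l\<^sup>2) * E p ?w ?w"
    proof -
      have "E p ?w (\<lambda>c. complex_of_real l *s ?w c) = cnj (of_real l * E p ?w ?w)"
        using herm[OF lw w] sc[OF w w] by simp
      also have "\<dots> = of_real l * E p ?w ?w" using herm[OF w w] by simp
      finally show ?thesis using sc[OF w lw, of "of_real l"] by (simp add: power2_eq_square)
    qed
    then have "tlength E p (\<lambda>c. complex_of_real l *s ?w c) = sqrt (l\<^sup>2 * Re (E p ?w ?w))"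
      unfolding tlength_def by simp
    also have "\<dots> \<ge> sqrt (l\<^sup>2 * K\<^sup>2)" using K by (intro real_sqrt_le_mono mult_left_mono) auto
    also have "sqrt (l\<^sup>2 * K\<^sup>2) = l * \<bar>K\<bar>" using l by (simp add: real_sqrt_mult)
    finally show ?thesis using l mult_left_mono[of K "\<bar>K\<bar>" l] by linarith
  qed
  then show ?thesis by blast
qed

section \<open>Holomorphic curves and their tangent vectors\<close>

lemma Hol_open_preimage:
  assumes "g \<in> Hol \<Delta> X A" "open \<Delta>" "openin X U"
  shows "open {w \<in> \<Delta>. g w \<in> U}"
proof -
  have "continuous_map (top_of_set \<Delta>) X g" using assms(1) by (simp add: Hol_def)
  then have "openin (top_of_set \<Delta>) {w \<in> \<Delta>. g w \<in> U}"
    using openin_continuous_map_preimage[OF _ assms(3)] by fastforce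
  then show ?thesis using assms(2) openin_open_trans by blast
qed

lemma Hol_coordinate_DERIV:
  assumes "g \<in> Hol \<Delta> X A" "open \<Delta>" "c \<in> A" "openin X (fst c)" "z \<in> \<Delta>" "g z \<in> fst c"
  shows "((\<lambda>w. snd c (g w) $ i) has_field_derivative deriv (\<lambda>w. snd c (g w) $ i) z) (at z)"
proof (rule holomorphic_derivI)
  show "(\<lambda>w. snd c (g w) $ i) holomorphic_on {w \<in> \<Delta>. g w \<in> fst c}"
    using assms(1,3) by (auto simp: Hol_def)
  show "open {w \<in> \<Delta>. g w \<in> fst c}" by (rule Hol_open_preimage) (use assms in auto)
qed (use assms in auto)

lemma has_derivative_vec_componentwise:
  fixes \<phi> :: "complex \<Rightarrow> complex ^ 'n"
  assumes "\<And>i. ((\<lambda>w. \<phi> w $ i) has_field_derivative d i) (at z)"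
  shows "(\<phi> has_derivative (\<lambda>h. \<chi> i. d i * h)) (at z)"
  unfolding has_derivative_componentwise_within[of \<phi>]
proof
  fix b :: "complex ^ 'n" assume "b \<in> Basis"
  then obtain i u where b: "b = axis i u" by (auto simp: Basis_vec_def)
  have "((\<lambda>w. inner (\<phi> w $ i) u) has_derivative (\<lambda>h. inner (d i * h) u)) (at z)"
    using assms[of i] unfolding has_field_derivative_def by (rule has_derivative_inner_left)
  then show "((\<lambda>x. inner (\<phi> x) b) has_derivative (\<lambda>x. inner (\<chi> i. d i * x) b)) (at z)"
    by (simp add: b inner_axis)
qed

text \<open>This is the chain rule: near z the coordinates in \<open>c'\<close> are the transition
  map applied to those in \<open>c\<close>. It makes derivatives of curves the source of all tangent
  vectors in the length estimate.\<close>

lemma curve_deriv_in_tangent_space: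
  fixes A :: "('a, 'n::finite) chart set"
  assumes g: "g \<in> Hol \<Delta> X A" and \<Delta>: "open \<Delta>" "z \<in> \<Delta>"
    and A: "\<And>c. c \<in> A \<Longrightarrow> openin X (fst c)" "\<And>c. c \<in> A \<Longrightarrow> inj_on (snd c) (fst c)"
    and tr: "\<And>c c'. c \<in> charts_at A (g z) \<Longrightarrow> c' \<in> charts_at A (g z) \<Longrightarrow>
      transition c c' differentiable (at (snd c (g z)))"
  shows "curve_deriv A g z \<in> tangent_space A (g z)"
proof (rule tangent_spaceI)
  fix c c' assume c: "c \<in> charts_at A (g z)" "c' \<in> charts_at A (g z)"
  have D: "((\<lambda>w. snd c (g w)) has_derivative (\<lambda>h. \<chi> i. deriv (\<lambda>w. snd c (g w) $ i) z * h)) (at z)"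
    if "c \<in> charts_at A (g z)" for c
    by (rule has_derivative_vec_componentwise, rule Hol_coordinate_DERIV[OF g])
      (use that A \<Delta> in \<open>auto simp: charts_at_def\<close>)
  let ?F = "frechet_derivative (transition c c') (at (snd c (g z)))"
  have "(transition c c' has_derivative ?F) (at (snd c (g z)))"
    using tr[OF c] frechet_derivative_works by blast
  from diff_chain_at[OF D[OF c(1)] this]
  have "((\<lambda>w. transition c c' (snd c (g w))) has_derivative
      (\<lambda>h. ?F (\<chi> i. deriv (\<lambda>w. snd c (g w) $ i) z * h))) (at z)"
    by (simp add: o_def)
  then have "((\<lambda>w. snd c' (g w)) has_derivative
      (\<lambda>h. ?F (\<chi> i. deriv (\<lambda>w. snd c (g w) $ i) z * h))) (at z)"
  proof (rule has_derivative_transform_within_open)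
    show "open {w \<in> \<Delta>. g w \<in> fst c \<inter> fst c'}"
      by (rule Hol_open_preimage[OF g]) (use \<Delta> A(1)[of c] A(1)[of c'] c in \<open>auto simp: charts_at_def\<close>)
    show "z \<in> {w \<in> \<Delta>. g w \<in> fst c \<inter> fst c'}" using \<Delta> c by (auto simp: charts_at_def)
    show "transition c c' (snd c (g w)) = snd c' (g w)" if "w \<in> {w \<in> \<Delta>. g w \<in> fst c \<inter> fst c'}" for w
      using that A(2)[of c] c by (simp add: transition_def charts_at_def)
  qed
  \<comment> \<open>The two derivatives agree as linear maps on the complex numbers; evaluation at 1
    gives the coordinate vectors.\<close>
  from has_derivative_unique[OF this D[OF c(2)]]
  have "?F (\<chi> i. deriv (\<lambda>w. snd c (g w) $ i) z) = (\<chi> i. deriv (\<lambda>w. snd c' (g w) $ i) z)"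
    by (metis (no_types, lifting) mult_1_right vec_lambda_unique)
  then show "curve_deriv A g z c' = ?F (curve_deriv A g z c)"
    using c by (simp add: curve_deriv_def)
qed (simp add: curve_deriv_def)

section \<open>Product charts and their transition maps\<close>

lemma inj_on_prod_chart:
  assumes "inj_on (snd c) (fst c)" "inj_on (snd c') (fst c')"
  shows "inj_on (snd (prod_chart c c')) (fst (prod_chart c c'))"
proof (rule inj_onI, clarify)
  fix x y x' y' assume *: "(x, y) \<in> fst (prod_chart c c')" "(x', y') \<in> fst (prod_chart c c')"
    "snd (prod_chart c c') (x, y) = snd (prod_chart c c') (x', y')"
  have "snd c x $ i = snd c x' $ i" for i
    using arg_cong[OF *(3), of "\<lambda>v. v $ Inl i"] by (simp add: prod_chart_def)
  moreover have "snd c' y $ i = snd c' y' $ i" for i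
    using arg_cong[OF *(3), of "\<lambda>v. v $ Inr i"] by (simp add: prod_chart_def)
  ultimately have "snd c x = snd c x'" "snd c' y = snd c' y'"
    by (simp_all add: vec_eq_iff)
  then show "x = x' \<and> y = y'"
    using *(1,2) assms by (auto simp: prod_chart_def dest: inj_onD)
qed

text \<open>Near the point the transition is \<open>J\<close> after the pair of factor transitions
  after the two projections, and the outer maps are linear. Real differentiability at one point is
  exactly what the tangent space lemmas ask for.\<close>

lemma transition_prod_chart_differentiable:
  fixes c\<^sub>1 c\<^sub>1' :: "('a, 'm::finite) chart" and c\<^sub>2 c\<^sub>2' :: "('b, 'n::finite) chart"
  assumes inj: "inj_on (snd c\<^sub>1) (fst c\<^sub>1)" "inj_on (snd c\<^sub>2) (fst c\<^sub>2)"
    and hol: "holomorphic_map_on (transition c\<^sub>1 c\<^sub>1') (snd c\<^sub>1 ` (fst c\<^sub>1 \<inter> fst c\<^sub>1'))"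
      "holomorphic_map_on (transition c\<^sub>2 c\<^sub>2') (snd c\<^sub>2 ` (fst c\<^sub>2 \<inter> fst c\<^sub>2'))"
    and p: "p \<in> fst (prod_chart c\<^sub>1 c\<^sub>2)" "p \<in> fst (prod_chart c\<^sub>1' c\<^sub>2')"
  shows "transition (prod_chart c\<^sub>1 c\<^sub>2) (prod_chart c\<^sub>1' c\<^sub>2') differentiable (at (snd (prod_chart c\<^sub>1 c\<^sub>2) p))"
proof -
  let ?T1 = "transition c\<^sub>1 c\<^sub>1'" and ?T2 = "transition c\<^sub>2 c\<^sub>2'"
  let ?V1 = "snd c\<^sub>1 ` (fst c\<^sub>1 \<inter> fst c\<^sub>1')" and ?V2 = "snd c\<^sub>2 ` (fst c\<^sub>2 \<inter> fst c\<^sub>2')"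
  let ?C = "snd (prod_chart c\<^sub>1 c\<^sub>2)"
  define \<pi>\<^sub>1 where "\<pi>\<^sub>1 = (\<lambda>x :: complex ^ ('m + 'n). \<chi> i. x $ Inl i)"
  define \<pi>\<^sub>2 where "\<pi>\<^sub>2 = (\<lambda>x :: complex ^ ('m + 'n). \<chi> j. x $ Inr j)"
  define J where "J = (\<lambda>ab :: (complex ^ 'm) \<times> (complex ^ 'n).
    (\<chi> k. case k of Inl i \<Rightarrow> fst ab $ i | Inr j \<Rightarrow> snd ab $ j) :: complex ^ ('m + 'n))"
  have lin: "bounded_linear \<pi>\<^sub>1" "bounded_linear \<pi>\<^sub>2" "bounded_linear J"
    unfolding \<pi>\<^sub>1_def \<pi>\<^sub>2_def J_def linear_conv_bounded_linear[symmetric]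
    by (auto intro!: linearI simp: vec_eq_iff split: sum.splits)
  have \<pi>C: "\<pi>\<^sub>1 (?C (x, y)) = snd c\<^sub>1 x" "\<pi>\<^sub>2 (?C (x, y)) = snd c\<^sub>2 y" for x y
    by (simp_all add: \<pi>\<^sub>1_def \<pi>\<^sub>2_def prod_chart_def vec_eq_iff)
  have op: "open ?V1" "open ?V2"
    and diff: "\<And>x. x \<in> ?V1 \<Longrightarrow> ?T1 differentiable (at x)" "\<And>x. x \<in> ?V2 \<Longrightarrow> ?T2 differentiable (at x)"
    using hol unfolding holomorphic_map_on_def differentiable_def by blast+
  obtain a b where ab: "p = (a, b)" "a \<in> fst c\<^sub>1 \<inter> fst c\<^sub>1'" "b \<in> fst c\<^sub>2 \<inter> fst c\<^sub>2'"
    using p by (cases p) (auto simp: prod_chart_def)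
  have 1: "(\<lambda>x. ?T1 (\<pi>\<^sub>1 x)) differentiable (at (?C p))"
    using differentiable_chain_at[of \<pi>\<^sub>1 "?C p" ?T1] diff(1)[of "snd c\<^sub>1 a"] ab \<pi>C lin
    by (simp add: o_def bounded_linear_imp_differentiable)
  have 2: "(\<lambda>x. ?T2 (\<pi>\<^sub>2 x)) differentiable (at (?C p))"
    using differentiable_chain_at[of \<pi>\<^sub>2 "?C p" ?T2] diff(2)[of "snd c\<^sub>2 b"] ab \<pi>C lin
    by (simp add: o_def bounded_linear_imp_differentiable)
  have "(\<lambda>x. (?T1 (\<pi>\<^sub>1 x), ?T2 (\<pi>\<^sub>2 x))) differentiable (at (?C p))"
    by (intro differentiable_Pair 1 2)
  then have "(\<lambda>x. J (?T1 (\<pi>\<^sub>1 x), ?T2 (\<pi>\<^sub>2 x))) differentiable (at (?C p))"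
    using differentiable_chain_at[of _ _ J] bounded_linear_imp_differentiable[OF lin(3)]
    by (fastforce simp: o_def)
  then obtain D where D: "((\<lambda>x. J (?T1 (\<pi>\<^sub>1 x), ?T2 (\<pi>\<^sub>2 x))) has_derivative D) (at (?C p))"
    unfolding differentiable_def by blast
  \<comment> \<open>The factorization holds only over the overlaps of both factors, where the
    inverse charts are genuine inverses; these form an open neighbourhood of the point.\<close>
  have "(transition (prod_chart c\<^sub>1 c\<^sub>2) (prod_chart c\<^sub>1' c\<^sub>2') has_derivative D) (at (?C p))"
    using D
  proof (rule has_derivative_transform_within_open)
    show "open (\<pi>\<^sub>1 -` ?V1 \<inter> \<pi>\<^sub>2 -` ?V2)"
      using op lin by (intro open_Int open_vimage linear_continuous_on)
    show "?C p \<in> \<pi>\<^sub>1 -` ?V1 \<inter> \<pi>\<^sub>2 -` ?V2" using ab by (simp add: \<pi>C)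
  next
    fix x assume "x \<in> \<pi>\<^sub>1 -` ?V1 \<inter> \<pi>\<^sub>2 -` ?V2"
    then obtain a b where ab: "a \<in> fst c\<^sub>1 \<inter> fst c\<^sub>1'" "b \<in> fst c\<^sub>2 \<inter> fst c\<^sub>2'"
      "\<pi>\<^sub>1 x = snd c\<^sub>1 a" "\<pi>\<^sub>2 x = snd c\<^sub>2 b" by auto
    have x: "x = ?C (a, b)"
      using ab(3,4) by (auto simp: \<pi>\<^sub>1_def \<pi>\<^sub>2_def prod_chart_def vec_eq_iff split: sum.splits)
    have "inv_into (fst (prod_chart c\<^sub>1 c\<^sub>2)) ?C x = (a, b)"
      unfolding x by (rule inv_into_f_f[OF inj_on_prod_chart[OF inj]]) (use ab in \<open>auto simp: prod_chart_def\<close>)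
    moreover have "inv_into (fst c\<^sub>1) (snd c\<^sub>1) (\<pi>\<^sub>1 x) = a" "inv_into (fst c\<^sub>2) (snd c\<^sub>2) (\<pi>\<^sub>2 x) = b"
      using ab inj by auto
    ultimately show "J (?T1 (\<pi>\<^sub>1 x), ?T2 (\<pi>\<^sub>2 x)) = transition (prod_chart c\<^sub>1 c\<^sub>2) (prod_chart c\<^sub>1' c\<^sub>2') x"
      by (simp add: transition_def J_def prod_chart_def)
  qed
  then show ?thesis unfolding differentiable_def by blast
qed

section \<open>Nonconstant curves and pointwise limits\<close>

text \<open>If all coordinate derivatives vanished, the coordinates would be constant on small
  balls; injectivity of charts would make \<open>f\<close> locally constant, and connectedness of
  the plane constant.\<close>

lemma Hol_nonconstant_deriv:
  assumes X: "complex_manifold X A" and f: "f \<in> Hol UNIV X A" and nc: "\<not> f constant_on UNIV"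
  obtains z c i where "c \<in> charts_at A (f z)" "deriv (\<lambda>w. snd c (f w) $ i) z \<noteq> 0"
proof -
  have A: "\<And>c. c \<in> A \<Longrightarrow> openin X (fst c)" "\<And>c. c \<in> A \<Longrightarrow> inj_on (snd c) (fst c)"
    and cov: "(\<Union>c\<in>A. fst c) = topspace X"
    using X unfolding complex_manifold_def
    by (auto simp: homeomorphic_eq_everything_map openin_subset inf_absorb2)
  have "f constant_on UNIV" if *: "\<And>z c i. c \<in> charts_at A (f z) \<Longrightarrow> deriv (\<lambda>w. snd c (f w) $ i) z = 0"
  proof (rule locally_constant_imp_constant)
    fix z :: complex
    have "f z \<in> topspace X" using f by (auto simp: Hol_def continuous_map_def)
    then obtain c where c: "c \<in> A" "f z \<in> fst c" using cov by blast
    let ?W = "{w \<in> UNIV. f w \<in> fst c}"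
    have "open ?W" by (rule Hol_open_preimage[OF f]) (use A c in auto)
    then obtain e where e: "e > 0" "ball z e \<subseteq> ?W" using c openE by blast
    have "f w = f z" if "w \<in> ball z e" for w
    proof -
      have "snd c (f w) $ i = snd c (f z) $ i" for i
      proof -
        have "((\<lambda>w. snd c (f w) $ i) has_field_derivative 0) (at y within ball z e)" if "y \<in> ball z e" for y
        proof (rule has_field_derivative_at_within)
          have y: "f y \<in> fst c" using that e by auto
          show "((\<lambda>w. snd c (f w) $ i) has_field_derivative 0) (at y)"
            using Hol_coordinate_DERIV[OF f open_UNIV c(1) A(1)[OF c(1)] UNIV_I y, of i]
              *[of c y i] y c(1) by (simp add: charts_at_def)
        qed
        from has_field_derivative_zero_constant[OF convex_ball this]
        obtain d where "\<And>y. y \<in> ball z e \<Longrightarrow> snd c (f y) $ i = d" by blast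
        then show ?thesis using that e by simp
      qed
      then have "snd c (f w) = snd c (f z)" by (simp add: vec_eq_iff)
      moreover have "f w \<in> fst c" using that e by auto
      ultimately show ?thesis using inj_onD[OF A(2)[OF c(1)] _ _ c(2)] by blast
    qed
    then have "\<forall>x\<in>ball z e. f x = f z" by blast
    moreover have "openin (top_of_set UNIV) (ball z e)" "z \<in> ball z e" using e(1) by simp_all
    ultimately show "\<exists>T. openin (top_of_set UNIV) T \<and> z \<in> T \<and> (\<forall>x\<in>T. f x = f z)" by blast
  qed (rule connected_UNIV)
  then show thesis using nc that by metis
qed

text \<open>Apply the uniform estimate to the compact set {z}. The existentially quantified distance
  disappears, and the later arguments need only these pointwise limits.\<close>

lemma conv_unif_on_compacts_limitin:
  assumes "conv_unif_on_compacts \<Delta> X f g" "z \<in> \<Delta>"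
  shows "limitin X (\<lambda>j. f j z) (g z) sequentially"
proof -
  obtain d where d: "Metric_space (topspace X) d" "Metric_space.mtopology (topspace X) d = X"
    and lim: "\<forall>K. compact K \<and> K \<subseteq> \<Delta> \<longrightarrow> (\<forall>\<epsilon>>0. \<forall>\<^sub>F j in sequentially. \<forall>z\<in>K.
      f j z \<in> topspace X \<and> d (f j z) (g z) < \<epsilon>)"
    using assms(1) unfolding conv_unif_on_compacts_def by (elim conjE exE)
  have "g z \<in> topspace X" using assms unfolding conv_unif_on_compacts_def by blast
  moreover have "\<forall>\<^sub>F j in sequentially. f j z \<in> topspace X \<and> d (f j z) (g z) < \<epsilon>" if "\<epsilon> > 0" for \<epsilon>
    using lim[rule_format, of "{z}" \<epsilon>] assms(2) that by simp
  ultimately have "limitin (Metric_space.mtopology (topspace X) d) (\<lambda>j. f j z) (g z) sequentially"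
    unfolding Metric_space.limitin_metric[OF d(1)] by blast
  then show ?thesis unfolding d(2) .
qed

section \<open>Curves in the product of a plane domain with the manifold\<close>

abbreviation plane_chart :: "complex set \<Rightarrow> (complex, 1) chart" where
  "plane_chart S \<equiv> (S, vec)"

lemma prod_plane_atlas_iff:
  "c \<in> prod_atlas (plane_atlas S) A \<longleftrightarrow> (\<exists>c'\<in>A. c = prod_chart (plane_chart S) c')"
  unfolding prod_atlas_def plane_atlas_def by blast

text \<open>This one shape covers the family itself as well as the horizontal curve (v constant) and
  the vertical curve (u constant) that span the tangent plane used for the length bound.\<close>

lemma curve_in_product_Hol:
  assumes u: "u holomorphic_on \<Delta>" "u ` \<Delta> \<subseteq> S" and f: "f \<in> Hol UNIV X A" and v: "v holomorphic_on \<Delta>"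
  shows "(\<lambda>w. (u w, f (v w))) \<in> Hol \<Delta> (prod_topology (top_of_set S) X) (prod_atlas (plane_atlas S) A)"
proof -
  have f': "continuous_map euclidean X f"
    "\<And>c i. c \<in> A \<Longrightarrow> (\<lambda>z. snd c (f z) $ i) holomorphic_on {z. f z \<in> fst c}"
    using f by (auto simp: Hol_def)
  have "continuous_map (top_of_set \<Delta>) X (f \<circ> v)"
    using f'(1) holomorphic_on_imp_continuous_on[OF v] by (intro continuous_map_compose) auto
  then have "continuous_map (top_of_set \<Delta>) (prod_topology (top_of_set S) X) (\<lambda>w. (u w, f (v w)))"
    using u holomorphic_on_imp_continuous_on[OF u(1)]
    by (simp add: continuous_map_pairwise o_def continuous_map_in_subtopology image_subset_iff)
  moreover have "(\<lambda>z. snd c (u z, f (v z)) $ k) holomorphic_on {z \<in> \<Delta>. (u z, f (v z)) \<in> fst c}"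
    if cB: "c \<in> prod_atlas (plane_atlas S) A" for c k
  proof -
    obtain c' where c': "c = prod_chart (plane_chart S) c'" "c' \<in> A"
      using cB unfolding prod_plane_atlas_iff by blast
    let ?W = "{z \<in> \<Delta>. (u z, f (v z)) \<in> fst c}"
    show ?thesis
    proof (cases k)
      case (Inl i)
      have "u holomorphic_on ?W" using u(1) by (rule holomorphic_on_subset) auto
      then show ?thesis by (simp add: c' Inl prod_chart_def)
    next
      case (Inr j)
      have "v holomorphic_on ?W" using v by (rule holomorphic_on_subset) auto
      then have "((\<lambda>z. snd c' (f z) $ j) \<circ> v) holomorphic_on ?W"
        by (rule holomorphic_on_compose_gen[OF _ f'(2)[OF c'(2)]]) (auto simp: c' prod_chart_def)
      then show ?thesis by (simp add: c' Inr prod_chart_def o_def)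
    qed
  qed
  ultimately show ?thesis by (simp add: Hol_def)
qed

lemma curve_deriv_in_product:
  assumes u: "(u has_field_derivative u') (at \<xi>)" and v: "(v has_field_derivative v') (at \<xi>)"
    and f: "f \<in> Hol UNIV X A" and c: "c \<in> charts_at A (f (v \<xi>))" "openin X (fst c)" and S: "u \<xi> \<in> S"
  shows "curve_deriv (prod_atlas (plane_atlas S) A) (\<lambda>w. (u w, f (v w))) \<xi> (prod_chart (plane_chart S) c) =
    (\<chi> k. case k of Inl i \<Rightarrow> u' | Inr j \<Rightarrow> v' * deriv (\<lambda>w. snd c (f w) $ j) (v \<xi>))"
proof -
  have ch: "prod_chart (plane_chart S) c \<in> charts_at (prod_atlas (plane_atlas S) A) (u \<xi>, f (v \<xi>))"
    using c S unfolding charts_at_def prod_plane_atlas_iff by (auto simp: prod_chart_def)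
  have "((\<lambda>w. snd c (f (v w)) $ j) has_field_derivative deriv (\<lambda>w. snd c (f w) $ j) (v \<xi>) * v') (at \<xi>)" for j
    using DERIV_chain2[OF Hol_coordinate_DERIV[OF f open_UNIV] v] c by (simp add: charts_at_def)
  then have "deriv (\<lambda>w. snd (prod_chart (plane_chart S) c) (u w, f (v w)) $ k) \<xi> =
      (case k of Inl (i :: 1) \<Rightarrow> u' | Inr j \<Rightarrow> v' * deriv (\<lambda>w. snd c (f w) $ j) (v \<xi>))" for k
    using DERIV_imp_deriv[OF u]
    by (cases k) (simp_all add: prod_chart_def DERIV_imp_deriv mult.commute)
  then show ?thesis using ch by (simp add: curve_deriv_def vec_eq_iff)
qed

lemma holomorphic_map_on_plane_transition:
  assumes "open S"
  shows "holomorphic_map_on (transition (plane_chart S) (plane_chart S)) (vec ` S)"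
proof -
  have "(vec ` S :: (complex ^ 1) set) = (\<lambda>x :: complex ^ 1. x $ 1) -` S"
  proof (intro set_eqI iffI)
    fix x :: "complex ^ 1" assume "x \<in> (\<lambda>x. x $ 1) -` S"
    moreover have "x = vec (x $ 1)" by (simp add: vec_eq_iff)
    ultimately show "x \<in> vec ` S" by blast
  qed auto
  then have op: "open (vec ` S :: (complex ^ 1) set)"
    using assms by (simp add: open_vimage continuous_on_component)
  have "(transition (plane_chart S) (plane_chart S) has_derivative (\<lambda>v. mat 1 *v v)) (at x)"
    if x: "x \<in> vec ` S" for x
    unfolding matrix_vector_mul_lid
  proof (rule has_derivative_transform_within_open[OF has_derivative_ident op x])
    show "y = transition (plane_chart S) (plane_chart S) y" if "y \<in> vec ` S" for y
      using that by (simp add: transition_def f_inv_into_f)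
  qed
  then show ?thesis
    unfolding holomorphic_map_on_def by (intro conjI op ballI exI[of _ "mat 1"])
qed

lemma complex_manifold_chart:
  assumes "complex_manifold X A" "c \<in> A"
  shows "openin X (fst c)" and "inj_on (snd c) (fst c)"
proof -
  have "\<forall>(U, \<phi>)\<in>A. openin X U \<and> open (\<phi> ` U) \<and>
      homeomorphic_map (subtopology X U) (top_of_set (\<phi> ` U)) \<phi>"
    using assms(1) unfolding complex_manifold_def by (elim conjE)
  from bspec[OF this assms(2)]
  have *: "openin X (fst c)" "homeomorphic_map (subtopology X (fst c)) (top_of_set (snd c ` fst c)) (snd c)"
    by (simp_all add: case_prod_unfold)
  show "openin X (fst c)" by (rule *(1))
  have "topspace (subtopology X (fst c)) = fst c"
    using openin_subset[OF *(1)] by (rule topspace_subtopology_subset)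
  then show "inj_on (snd c) (fst c)"
    using homeomorphic_imp_injective_map[OF *(2)] by simp
qed

lemma complex_manifold_transition:
  assumes "complex_manifold X A" "c \<in> A" "c' \<in> A"
  shows "holomorphic_map_on (transition c c') (snd c ` (fst c \<inter> fst c'))"
proof -
  have "\<forall>c\<in>A. \<forall>c'\<in>A. holomorphic_map_on (transition c c') (snd c ` (fst c \<inter> fst c'))"
    using assms(1) unfolding complex_manifold_def by (elim conjE)
  from bspec[OF bspec[OF this assms(2)] assms(3)] show ?thesis .
qed

lemma inj_on_plane_chart: "inj_on (snd (plane_chart S)) (fst (plane_chart S))"
  by (rule inj_onI) (simp add: vec_eq_iff)

lemma prod_plane_atlas_chart:
  assumes "complex_manifold X A" "c \<in> prod_atlas (plane_atlas S) A"
  shows "openin (prod_topology (top_of_set S) X) (fst c)" and "inj_on (snd c) (fst c)"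
proof -
  obtain c' where c': "c' \<in> A" "c = prod_chart (plane_chart S) c'"
    using assms(2) unfolding prod_plane_atlas_iff by blast
  note c'' = complex_manifold_chart[OF assms(1) c'(1)]
  show "openin (prod_topology (top_of_set S) X) (fst c)"
    using c''(1) by (simp add: c' prod_chart_def openin_prod_Times_iff)
  show "inj_on (snd c) (fst c)"
    unfolding c'(2) by (rule inj_on_prod_chart[OF inj_on_plane_chart c''(2)])
qed

lemma prod_plane_atlas_transition_differentiable:
  assumes X: "complex_manifold X A" and S: "open S"
    and c: "c \<in> charts_at (prod_atlas (plane_atlas S) A) q" "c' \<in> charts_at (prod_atlas (plane_atlas S) A) q"
  shows "transition c c' differentiable (at (snd c q))"
proof -
  obtain d where d: "d \<in> A" "c = prod_chart (plane_chart S) d"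
    using c(1) unfolding charts_at_def prod_plane_atlas_iff by blast
  obtain d' where d': "d' \<in> A" "c' = prod_chart (plane_chart S) d'"
    using c(2) unfolding charts_at_def prod_plane_atlas_iff by blast
  have q: "q \<in> fst (prod_chart (plane_chart S) d)" "q \<in> fst (prod_chart (plane_chart S) d')"
    using c unfolding d(2) d'(2) charts_at_def by simp_all
  have pl: "holomorphic_map_on (transition (plane_chart S) (plane_chart S))
      (snd (plane_chart S) ` (fst (plane_chart S) \<inter> fst (plane_chart S)))"
    using holomorphic_map_on_plane_transition[OF S] by simp
  show ?thesis unfolding d(2) d'(2)
    by (rule transition_prod_chart_differentiable[OF inj_on_plane_chart complex_manifold_chart(2)[OF X d(1)]
          pl complex_manifold_transition[OF X d(1) d'(1)] q])
qed

text \<open>A curve with u' = l and v' = M l has tangent vector l (H + M V), with H and V the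
  horizontal and vertical vectors at the point; V is nonzero since f has nonzero derivative at
  \<open>z\<^sub>0\<close>. The threshold comes before u and v in the quantifiers, which allows
  \<open>h\<close> to be built from it.\<close>

lemma curve_in_product_tlength:
  fixes X :: "'a topology" and A :: "('a, 'n::finite) chart set" and K :: real
  assumes X: "complex_manifold X A" and f: "f \<in> Hol UNIV X A"
    and c0: "c\<^sub>0 \<in> charts_at A (f z\<^sub>0)" "deriv (\<lambda>w. snd c\<^sub>0 (f w) $ i\<^sub>0) z\<^sub>0 \<noteq> 0"
    and S: "open S" "x\<^sub>0 \<in> S"
    and E: "hermitian_metric (prod_topology (top_of_set S) X) (prod_atlas (plane_atlas S) A) E"
  shows "\<exists>N. \<forall>M\<ge>N. \<forall>u v \<xi> l. l \<ge> 0 \<longrightarrow> u \<xi> = x\<^sub>0 \<longrightarrow> v \<xi> = z\<^sub>0 \<longrightarrow>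
    (u has_field_derivative of_real l) (at \<xi>) \<longrightarrow> (v has_field_derivative of_real (M * l)) (at \<xi>) \<longrightarrow>
    l * K \<le> tlength E (x\<^sub>0, f z\<^sub>0) (curve_deriv (prod_atlas (plane_atlas S) A) (\<lambda>w. (u w, f (v w))) \<xi>)"
proof -
  define Y where "Y = prod_topology (top_of_set S) X"
  define B where "B = prod_atlas (plane_atlas S) A"
  note B = prod_plane_atlas_chart[OF X, where S = S, folded Y_def B_def]
  note tr = prod_plane_atlas_transition_differentiable[OF X S(1), folded B_def]
  note A = complex_manifold_chart[OF X]
  note deriv_B = curve_deriv_in_product[where S = S and f = f and A = A and X = X, folded B_def]
  have fX: "f z \<in> topspace X" for z using f by (auto simp: Hol_def continuous_map_def)
  \<comment> \<open>Taking both vectors as derivatives of actual curves gives their membership in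
    the tangent space for free.\<close>
  define T\<^sub>1 where "T\<^sub>1 = curve_deriv B (\<lambda>w. (w, f z\<^sub>0)) x\<^sub>0"
  define T\<^sub>2 where "T\<^sub>2 = curve_deriv B (\<lambda>w. (x\<^sub>0, f w)) z\<^sub>0"
  have T1_chart: "T\<^sub>1 (prod_chart (plane_chart S) c) = (\<chi> j. case j of Inl i \<Rightarrow> 1 | Inr j \<Rightarrow> 0)"
    and T2_chart: "T\<^sub>2 (prod_chart (plane_chart S) c) =
      (\<chi> j. case j of Inl i \<Rightarrow> 0 | Inr j \<Rightarrow> deriv (\<lambda>w. snd c (f w) $ j) z\<^sub>0)"
    if c: "c \<in> charts_at A (f z\<^sub>0)" for c
  proof -
    have op: "openin X (fst c)" using c A(1) unfolding charts_at_def by blast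
    show "T\<^sub>1 (prod_chart (plane_chart S) c) = (\<chi> j. case j of Inl i \<Rightarrow> 1 | Inr j \<Rightarrow> 0)"
      unfolding T\<^sub>1_def
      using deriv_B[where u = "\<lambda>w. w" and v = "\<lambda>w. z\<^sub>0", OF DERIV_ident DERIV_const f c op S(2)]
      unfolding mult_zero_left .
    show "T\<^sub>2 (prod_chart (plane_chart S) c) =
        (\<chi> j. case j of Inl i \<Rightarrow> 0 | Inr j \<Rightarrow> deriv (\<lambda>w. snd c (f w) $ j) z\<^sub>0)"
      unfolding T\<^sub>2_def
      using deriv_B[where u = "\<lambda>w. x\<^sub>0" and v = "\<lambda>w. w", OF DERIV_const DERIV_ident f c op S(2)]
      unfolding mult_1 .
  qed
  have T1: "T\<^sub>1 \<in> tangent_space B (x\<^sub>0, f z\<^sub>0)"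
  proof -
    have "(\<lambda>w. (w, f z\<^sub>0)) \<in> Hol S Y B"
      unfolding Y_def B_def
      by (rule curve_in_product_Hol[OF holomorphic_on_ident _ f holomorphic_on_const]) auto
    then show ?thesis unfolding T\<^sub>1_def by (rule curve_deriv_in_tangent_space[OF _ S B tr])
  qed
  have T2: "T\<^sub>2 \<in> tangent_space B (x\<^sub>0, f z\<^sub>0)"
  proof -
    have "(\<lambda>w. (x\<^sub>0, f w)) \<in> Hol UNIV Y B"
      unfolding Y_def B_def
      by (rule curve_in_product_Hol[OF holomorphic_on_const _ f holomorphic_on_ident]) (use S in auto)
    then show ?thesis unfolding T\<^sub>2_def by (rule curve_deriv_in_tangent_space[OF _ open_UNIV UNIV_I B tr])
  qed
  have "T\<^sub>2 (prod_chart (plane_chart S) c\<^sub>0) $ Inr i\<^sub>0 \<noteq> 0" using c0 by (simp add: T2_chart)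
  then have T2_nz: "T\<^sub>2 \<noteq> (\<lambda>c. 0)" by (metis zero_index)
  have "(x\<^sub>0, f z\<^sub>0) \<in> topspace Y" using S fX by (simp add: Y_def)
  from tlength_lower_bound[OF E[folded Y_def B_def] this tr T1 T2 T2_nz, of K]
  obtain N where N: "\<And>M l. M \<ge> N \<Longrightarrow> l \<ge> 0 \<Longrightarrow> l * K \<le> tlength E (x\<^sub>0, f z\<^sub>0)
      (\<lambda>c. complex_of_real l *s (T\<^sub>1 c + complex_of_real M *s T\<^sub>2 c))"
    by blast
  have "curve_deriv B (\<lambda>w. (u w, f (v w))) \<xi> = (\<lambda>c. complex_of_real l *s (T\<^sub>1 c + complex_of_real M *s T\<^sub>2 c))"
    if \<xi>: "u \<xi> = x\<^sub>0" "v \<xi> = z\<^sub>0" and du: "(u has_field_derivative of_real l) (at \<xi>)"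
      and dv: "(v has_field_derivative of_real (M * l)) (at \<xi>)" for u v \<xi> l M
  proof
    fix c
    show "curve_deriv B (\<lambda>w. (u w, f (v w))) \<xi> c = complex_of_real l *s (T\<^sub>1 c + complex_of_real M *s T\<^sub>2 c)"
    proof (cases "c \<in> charts_at B (x\<^sub>0, f z\<^sub>0)")
      case True
      then obtain c' where c': "c' \<in> A" "c = prod_chart (plane_chart S) c'"
        unfolding charts_at_def B_def prod_plane_atlas_iff by blast
      have ch: "c' \<in> charts_at A (f z\<^sub>0)"
        using True c' by (simp add: charts_at_def prod_chart_def)
      have "curve_deriv B (\<lambda>w. (u w, f (v w))) \<xi> c = (\<chi> j. case j of Inl i \<Rightarrow> of_real l
          | Inr j \<Rightarrow> of_real (M * l) * deriv (\<lambda>w. snd c' (f w) $ j) z\<^sub>0)"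
        using deriv_B[OF du dv f, of c'] ch A(1)[OF c'(1)] S(2) unfolding \<xi> c'(2) by blast
      then show ?thesis
        unfolding c'(2) T1_chart[OF ch] T2_chart[OF ch]
        by (simp add: vec_eq_iff split: sum.splits)
    next
      \<comment> \<open>In charts that miss the point \<open>curve_deriv\<close> is 0 by convention,
        so both sides vanish.\<close>
      case False
      then show ?thesis by (simp add: curve_deriv_def \<xi> T\<^sub>1_def T\<^sub>2_def)
    qed
  qed
  then show ?thesis
    unfolding B_def[symmetric] using N by (intro exI[of _ N] allI impI) simp
qed

section \<open>The graph family and its rescaled limits\<close>

lemma limit_typeE:
  assumes "limit_type X A E" "open \<Delta>" "connected \<Delta>" "\<Delta> \<noteq> {}" "F \<subseteq> Hol \<Delta> X A"
    and "\<not> normal_family \<Delta> X F" "\<not> (\<exists>f. range f \<subseteq> F \<and> compactly_divergent \<Delta> X f)"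
  obtains p f \<rho> g where "range f \<subseteq> F" "\<And>j. \<rho> j > (0::real)"
    "conv_unif_on_compacts UNIV X (\<lambda>j \<xi>. f j (p j + of_real (\<rho> j) * \<xi>)) g"
    "brody_curve X A E g" "\<not> g constant_on UNIV"
proof -
  have "\<exists>p p0 f \<rho> g. range p \<subseteq> \<Delta> \<and> p0 \<in> \<Delta> \<and> p \<longlonglongrightarrow> p0 \<and> range f \<subseteq> F \<and>
      (\<forall>j. \<rho> j > 0) \<and> \<rho> \<longlonglongrightarrow> (0::real) \<and>
      conv_unif_on_compacts UNIV X (\<lambda>j \<xi>. f j (p j + of_real (\<rho> j) * \<xi>)) g \<and>
      brody_curve X A E g \<and> \<not> g constant_on UNIV"
    by (rule assms(1)[unfolded limit_type_def, rule_format]) (intro conjI assms(2-))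
  then show thesis using that by (elim exE conjE) blast
qed

text \<open>The hypotheses on \<theta> isolate what the two planar factors share.
  \<open>escape\<close> defeats normality, \<open>rescale\<close> identifies limits that stay in
  \<open>S\<close>, and \<open>pts\<close> lets the limit curve pass over every positive integer k
  at a place where \<theta> has real derivative at least 1, so that the horizontal speed there is
  real and at least \<open>b\<close>.\<close>

lemma not_limit_type_graph_family:
  fixes X :: "'a topology" and A :: "('a, 'n::finite) chart set" and \<theta> :: "complex \<Rightarrow> complex"
  assumes X: "complex_manifold X A" and f: "f \<in> Hol UNIV X A" "\<not> f constant_on UNIV"
    and S: "open S" and \<theta>: "\<theta> holomorphic_on UNIV" "range \<theta> \<subseteq> S"
    and escape: "filterlim (\<lambda>n. \<theta> (of_nat n)) at_infinity sequentially"
    and rescale: "\<And>\<alpha> \<beta> l. (\<And>j. \<beta> j > 0) \<Longrightarrow>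
      (\<And>\<xi>. (\<lambda>j. \<theta> (\<alpha> j + of_real (\<beta> j) * \<xi>)) \<longlonglongrightarrow> l \<xi>) \<Longrightarrow> (\<And>\<xi>. l \<xi> \<in> S) \<Longrightarrow>
      \<exists>a b. b \<ge> 0 \<and> l = (\<lambda>\<xi>. \<theta> (a + of_real b * \<xi>))"
    and pts: "\<And>k. k > 0 \<Longrightarrow> \<exists>w s. s \<ge> 1 \<and> \<theta> w = of_nat k \<and> (\<theta> has_field_derivative of_real s) (at w)"
    and E: "hermitian_metric (prod_topology (top_of_set S) X) (prod_atlas (plane_atlas S) A) E"
  shows "\<not> limit_type (prod_topology (top_of_set S) X) (prod_atlas (plane_atlas S) A) E"
proof
  define Y where "Y = prod_topology (top_of_set S) X"
  define B where "B = prod_atlas (plane_atlas S) A"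
  note YB = Y_def[symmetric] B_def[symmetric]
  assume "limit_type (prod_topology (top_of_set S) X) (prod_atlas (plane_atlas S) A) E"
  then have LT: "limit_type Y B E" by (simp add: YB)
  note E = E[unfolded YB]
  have haus: "Hausdorff_space X" using X unfolding complex_manifold_def by blast
  obtain z\<^sub>0 c\<^sub>0 i\<^sub>0 where c0: "c\<^sub>0 \<in> charts_at A (f z\<^sub>0)" "deriv (\<lambda>w. snd c\<^sub>0 (f w) $ i\<^sub>0) z\<^sub>0 \<noteq> 0"
    using Hol_nonconstant_deriv[OF X f] by blast
  have fX: "f z \<in> topspace X" for z using f by (auto simp: Hol_def continuous_map_def)
  have kS: "of_nat k \<in> S" if "k > 0" for k using pts[OF that] \<theta>(2) by (metis rangeI subsetD)
  \<comment> \<open>The required factor is k itself, so that the forced lengths outgrow every bound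
    once multiplied by a fixed positive speed.\<close>
  define large where "large = (\<lambda>k M. \<forall>u v \<xi> l. l \<ge> 0 \<longrightarrow> u \<xi> = of_nat k \<longrightarrow> v \<xi> = z\<^sub>0 \<longrightarrow>
      (u has_field_derivative of_real l) (at \<xi>) \<longrightarrow> (v has_field_derivative of_real (M * l)) (at \<xi>) \<longrightarrow>
      l * real k \<le> tlength E (of_nat k, f z\<^sub>0) (curve_deriv B (\<lambda>w. (u w, f (v w))) \<xi>))"
  have "\<exists>N. \<forall>M\<ge>N. large k M" if "k > 0" for k
    unfolding large_def B_def
    by (rule curve_in_product_tlength[OF X f(1) c0 S kS[OF that] E[unfolded Y_def B_def]])
  then obtain N where N: "\<And>k M. k > 0 \<Longrightarrow> M \<ge> N k \<Longrightarrow> large k M" by metis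
  obtain h r where h: "h holomorphic_on UNIV" "\<And>k. k > 0 \<Longrightarrow> h (of_nat k) = z\<^sub>0"
    "\<And>k. k > 0 \<Longrightarrow> (h has_field_derivative of_real (r k)) (at (of_nat k))" "\<And>k. k > 0 \<Longrightarrow> r k \<ge> N k"
    using entire_interpolation by blast

  \<comment> \<open>The shift to \<open>Suc n\<close> makes every dilation factor positive, which
    later gives \<beta> positive values.\<close>
  define F where "F = (\<lambda>n z. (\<theta> (of_nat (Suc n) * z), f (h (\<theta> (of_nat (Suc n) * z)))))"
  have "F n \<in> Hol UNIV Y B" for n
  proof -
    have "(\<lambda>z. \<theta> (of_nat (Suc n) * z)) holomorphic_on UNIV"
      using holomorphic_on_compose_gen[of "\<lambda>z. of_nat (Suc n) * z" UNIV \<theta> UNIV] \<theta>(1)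
      by (simp add: o_def holomorphic_intros)
    moreover from this have "(\<lambda>z. h (\<theta> (of_nat (Suc n) * z))) holomorphic_on UNIV"
      using holomorphic_on_compose_gen[OF _ h(1)] by (simp add: o_def)
    ultimately show ?thesis unfolding F_def Y_def B_def
      using \<theta>(2) f(1) by (intro curve_in_product_Hol) auto
  qed
  then have "range F \<subseteq> Hol UNIV Y B" by blast
  moreover have "\<not> normal_family UNIV Y (range F)"
  proof
    assume "normal_family UNIV Y (range F)"
    then obtain \<sigma> g where \<sigma>: "strict_mono (\<sigma> :: nat \<Rightarrow> nat)" "conv_unif_on_compacts UNIV Y (F \<circ> \<sigma>) g"
      unfolding normal_family_def by blast
    \<comment> \<open>At z = 1 the first component is \<theta> at the integer
      \<open>Suc (\<sigma> j)\<close>: a limit in the product would make it converge, while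
      \<open>escape\<close> sends it to infinity.\<close>
    have "limitin Y (\<lambda>j. F (\<sigma> j) 1) (g 1) sequentially"
      using conv_unif_on_compacts_limitin[OF \<sigma>(2), of 1] by simp
    then have "(\<lambda>j. \<theta> (of_nat (Suc (\<sigma> j)))) \<longlonglongrightarrow> fst (g 1)"
      using S unfolding Y_def limitin_pairwise by (simp add: F_def o_def)
    moreover have "filterlim (\<lambda>j. \<theta> (of_nat (Suc (\<sigma> j)))) at_infinity sequentially"
      using filterlim_compose[OF escape filterlim_compose[OF filterlim_Suc filterlim_subseq[OF \<sigma>(1)]]] .
    ultimately show False using not_tendsto_and_filterlim_at_infinity by (metis sequentially_bot)
  qed
  moreover have "\<not> (\<exists>fs. range fs \<subseteq> range F \<and> compactly_divergent UNIV Y fs)"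
  proof
    assume "\<exists>fs. range fs \<subseteq> range F \<and> compactly_divergent UNIV Y fs"
    then obtain fs where fs: "range fs \<subseteq> range F" "compactly_divergent UNIV Y fs" by blast
    \<comment> \<open>All members of the family take the same value at 0, so the compact sets {0}
      and {?p} contradict compact divergence.\<close>
    let ?p = "(\<theta> 0, f (h (\<theta> 0)))"
    have "?p \<in> topspace Y" using \<theta>(2) fX by (auto simp: Y_def)
    then have "compactin Y {?p}" by simp
    then obtain j where "fs j ` {0} \<inter> {?p} = {}"
      using fs(2) unfolding compactly_divergent_def by (metis compact_sing le_refl subset_UNIV)
    moreover obtain n where "fs j = F n" using fs(1) by blast
    ultimately show False by (simp add: F_def)
  qed
  ultimately obtain p fs \<rho> g where fs: "range fs \<subseteq> range F" and \<rho>: "\<And>j. \<rho> j > (0::real)"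
    and conv: "conv_unif_on_compacts UNIV Y (\<lambda>j \<xi>. fs j (p j + of_real (\<rho> j) * \<xi>)) g"
    and g: "brody_curve Y B E g" "\<not> g constant_on UNIV"
    by (rule limit_typeE[OF LT open_UNIV connected_UNIV UNIV_not_empty]) blast
  have "\<exists>n. fs j = F n" for j using fs by blast
  then obtain n where n: "\<And>j. fs j = F (n j)" by metis
  \<comment> \<open>A dilation after an affine rescaling is again affine with positive real slope.
    Since \<open>n j\<close> may grow while \<rho> tends to 0, no convergence of \<alpha> or \<beta>
    is known at this point.\<close>
  define \<alpha> \<beta> where "\<alpha> = (\<lambda>j. of_nat (Suc (n j)) * p j)" and "\<beta> = (\<lambda>j. real (Suc (n j)) * \<rho> j)"
  define \<psi> where "\<psi> = (\<lambda>j \<xi>. \<theta> (\<alpha> j + of_real (\<beta> j) * \<xi>))"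
  have fs_eq: "fs j (p j + of_real (\<rho> j) * \<xi>) = (\<psi> j \<xi>, f (h (\<psi> j \<xi>)))" for j \<xi>
    by (simp add: n F_def \<psi>_def \<alpha>_def \<beta>_def algebra_simps)
  have lim: "limitin Y (\<lambda>j. (\<psi> j \<xi>, f (h (\<psi> j \<xi>)))) (g \<xi>) sequentially" for \<xi>
    using conv_unif_on_compacts_limitin[OF conv, of \<xi>] by (simp add: fs_eq)
  then have lim1: "(\<lambda>j. \<psi> j \<xi>) \<longlonglongrightarrow> fst (g \<xi>)" and gS: "fst (g \<xi>) \<in> S"
    and lim2: "limitin X (\<lambda>j. f (h (\<psi> j \<xi>))) (snd (g \<xi>)) sequentially" for \<xi>
    using S unfolding Y_def limitin_pairwise by (simp_all add: o_def)
  have "\<exists>a b. b \<ge> 0 \<and> (\<lambda>\<xi>. fst (g \<xi>)) = (\<lambda>\<xi>. \<theta> (a + of_real b * \<xi>))"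
    by (rule rescale[of \<beta> \<alpha>, OF _ lim1[unfolded \<psi>_def] gS]) (use \<rho> in \<open>simp add: \<beta>_def\<close>)
  then obtain a b where ab: "b \<ge> 0" "\<And>\<xi>. fst (g \<xi>) = \<theta> (a + of_real b * \<xi>)" by metis
  \<comment> \<open>Continuity of \<open>f\<close> and \<open>h\<close> carries the limit of the
    first component over to the second, and limits in \<open>X\<close> are unique because it is
    Hausdorff.\<close>
  have "snd (g \<xi>) = f (h (fst (g \<xi>)))" for \<xi>
  proof (rule limitin_Hausdorff_unique[OF lim2 _ _ haus])
    have "isCont h (fst (g \<xi>))"
      using h(1) by (metis UNIV_I continuous_on_eq_continuous_at holomorphic_on_imp_continuous_on open_UNIV)
    then have "(\<lambda>j. h (\<psi> j \<xi>)) \<longlonglongrightarrow> h (fst (g \<xi>))" using isCont_tendsto_compose lim1 by blast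
    moreover have "continuous_map euclidean X f" using f by (simp add: Hol_def)
    ultimately show "limitin X (\<lambda>j. f (h (\<psi> j \<xi>))) (f (h (fst (g \<xi>)))) sequentially"
      using continuous_map_limit[of euclidean X f "\<lambda>j. h (\<psi> j \<xi>)"] by (simp add: o_def)
  qed simp
  then have g_eq: "g = (\<lambda>\<xi>. (\<theta> (a + of_real b * \<xi>), f (h (\<theta> (a + of_real b * \<xi>)))))"
    by (auto simp: ab prod_eq_iff)
  have "b > 0" using ab(1) g(2) unfolding g_eq by (cases "b = 0") (auto simp: constant_on_def)
  obtain C where C: "\<And>z. tlength E (g z) (curve_deriv B g z) \<le> C"
    using g(1) unfolding brody_curve_def by blast
  \<comment> \<open>Only now, with \<open>b\<close> and \<open>C\<close> both known, is the test
    point chosen.\<close>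
  obtain k where k: "k > 0" "C < b * real k"
  proof -
    obtain k where "C / b < real k" using reals_Archimedean2 by blast
    then have "C / b < real (Suc k)" by simp
    then show thesis using that[of "Suc k"] \<open>b > 0\<close> by (simp add: field_simps)
  qed
  obtain w s where w: "s \<ge> 1" "\<theta> w = of_nat k" "(\<theta> has_field_derivative of_real s) (at w)"
    using pts[OF k(1)] by blast
  define \<xi> where "\<xi> = (w - a) / of_real b"
  have \<xi>: "a + of_real b * \<xi> = w" using \<open>b > 0\<close> by (simp add: \<xi>_def)
  have du: "((\<lambda>\<xi>. \<theta> (a + of_real b * \<xi>)) has_field_derivative of_real (b * s)) (at \<xi>)"
  proof -
    have "((\<lambda>\<xi>. a + of_real b * \<xi>) has_field_derivative of_real b) (at \<xi>)"
      by (auto intro!: derivative_eq_intros)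
    from DERIV_chain2[of \<theta>, OF _ this, unfolded \<xi>, OF w(3)] show ?thesis
      by (simp add: mult.commute)
  qed
  \<comment> \<open>The derivative is kept in the form M l with M = \<open>r k\<close> and l =
    \<open>b * s\<close>, matching the property \<open>large\<close>.\<close>
  have dv: "((\<lambda>\<xi>. h (\<theta> (a + of_real b * \<xi>))) has_field_derivative of_real (r k * (b * s))) (at \<xi>)"
    unfolding of_real_mult[of "r k"]
    by (rule DERIV_chain2[OF _ du]) (use h(3)[OF k(1)] w(2) in \<open>simp add: \<xi>\<close>)
  have "g \<xi> = (of_nat k, f z\<^sub>0)" using w(2) h(2)[OF k(1)] by (simp add: g_eq \<xi>)
  then have "b * s * real k \<le> tlength E (g \<xi>) (curve_deriv B g \<xi>)"
    using N[OF k(1) h(4)[OF k(1)], unfolded large_def, rule_format, OF _ _ _ du dv]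
      \<open>b > 0\<close> w(1,2) h(2)[OF k(1)] by (simp add: g_eq \<xi>)
  moreover have "b * real k \<le> b * s * real k"
    using \<open>b > 0\<close> w(1) by (intro mult_right_mono) auto
  ultimately show False using C[of \<xi>] k(2) by linarith
qed

section \<open>The plane with the identity, the punctured plane with the exponential\<close>

theorem theorem7:
  fixes X :: "'a topology" and A :: "('a, 'n::finite) chart set"
  assumes "complex_manifold X A"
    and "\<exists>f. f \<in> Hol UNIV X A \<and> \<not> f constant_on UNIV"
  shows "(\<forall>E. hermitian_metric (prod_topology (top_of_set UNIV) X) (prod_atlas (plane_atlas UNIV) A) E
            \<longrightarrow> \<not> limit_type (prod_topology (top_of_set UNIV) X) (prod_atlas (plane_atlas UNIV) A) E) \<and>
         (\<forall>E. hermitian_metric (prod_topology (top_of_set (- {0})) X) (prod_atlas (plane_atlas (- {0})) A) E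
            \<longrightarrow> \<not> limit_type (prod_topology (top_of_set (- {0})) X) (prod_atlas (plane_atlas (- {0})) A) E)"
proof -
  obtain f where f: "f \<in> Hol UNIV X A" "\<not> f constant_on UNIV" using assms(2) by blast
  show ?thesis
  proof (intro conjI allI impI)
    fix E
    assume "hermitian_metric (prod_topology (top_of_set UNIV) X) (prod_atlas (plane_atlas UNIV) A) E"
    then show "\<not> limit_type (prod_topology (top_of_set UNIV) X) (prod_atlas (plane_atlas UNIV) A) E"
    proof (rule not_limit_type_graph_family[OF assms(1) f, where \<theta> = "\<lambda>w. w", rotated -1])
      fix \<alpha> and l :: "complex \<Rightarrow> complex" and \<beta> :: "nat \<Rightarrow> real"
      assume \<beta>: "\<And>j. \<beta> j > 0" and l: "\<And>\<xi>. (\<lambda>j. \<alpha> j + of_real (\<beta> j) * \<xi>) \<longlonglongrightarrow> l \<xi>"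
      \<comment> \<open>Subtracting the limits at 1 and 0 cancels \<alpha> and leaves the limit of
        \<beta>, a limit of positive reals.\<close>
      define b where "b = Re (l 1 - l 0)"
      have "(\<lambda>j. complex_of_real (\<beta> j)) \<longlonglongrightarrow> l 1 - l 0"
        using tendsto_diff[OF l[of 1] l[of 0]] by simp
      then have "(\<lambda>j. \<beta> j) \<longlonglongrightarrow> b" using tendsto_Re by (fastforce simp: b_def)
      then have b: "b \<ge> 0" "(\<lambda>j. complex_of_real (\<beta> j)) \<longlonglongrightarrow> of_real b"
        using \<beta> by (auto intro: LIMSEQ_le_const less_imp_le tendsto_of_real)
      have "l \<xi> = l 0 + of_real b * \<xi>" for \<xi>
        using LIMSEQ_unique[OF l[of \<xi>]] tendsto_add[OF l[of 0] tendsto_mult_right[OF b(2), of \<xi>]] by simp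
      then show "\<exists>a b. b \<ge> 0 \<and> l = (\<lambda>\<xi>. a + of_real b * \<xi>)" using b(1) by blast
    next
      show "\<exists>w s. s \<ge> 1 \<and> w = (of_nat k :: complex) \<and> ((\<lambda>w. w) has_field_derivative of_real s) (at w)" for k
        by (intro exI[of _ "of_nat k"] exI[of _ 1]) simp
    qed (auto simp: tendsto_of_nat)
  next
    fix E
    assume "hermitian_metric (prod_topology (top_of_set (- {0})) X) (prod_atlas (plane_atlas (- {0})) A) E"
    then show "\<not> limit_type (prod_topology (top_of_set (- {0})) X) (prod_atlas (plane_atlas (- {0})) A) E"
    proof (rule not_limit_type_graph_family[OF assms(1) f, where \<theta> = exp, rotated -1])
      fix \<alpha> and l :: "complex \<Rightarrow> complex" and \<beta> :: "nat \<Rightarrow> real"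
      assume \<beta>: "\<And>j. \<beta> j > 0" and l: "\<And>\<xi>. (\<lambda>j. exp (\<alpha> j + of_real (\<beta> j) * \<xi>)) \<longlonglongrightarrow> l \<xi>"
        and l0: "\<And>\<xi>. l \<xi> \<in> - {0}"
      \<comment> \<open>The quotient of the limits at 1 and 0 cancels exp(\<alpha>), and its norm is
        the limit of exp(\<beta>). That \<open>l\<close> avoids 0 is what permits the quotient and
        the logarithm.\<close>
      define b where "b = ln (norm (l 1 / l 0))"
      have nz: "l \<xi> \<noteq> 0" for \<xi> using l0[of \<xi>] by simp
      have "(\<lambda>j. norm (exp (complex_of_real (\<beta> j)))) \<longlonglongrightarrow> norm (l 1 / l 0)"
        using tendsto_norm[OF tendsto_divide[OF l[of 1] l[of 0] nz]] by (simp add: exp_add)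
      then have "(\<lambda>j. ln (exp (\<beta> j))) \<longlonglongrightarrow> b"
        unfolding b_def by (intro tendsto_ln) (simp_all add: nz)
      then have b: "b \<ge> 0" "(\<lambda>j. complex_of_real (\<beta> j)) \<longlonglongrightarrow> of_real b"
        using \<beta> by (auto intro: LIMSEQ_le_const less_imp_le tendsto_of_real)
      \<comment> \<open>The sequence \<alpha> is controlled only modulo 2 pi i and need not
        converge, so \<open>a\<close> is taken as any logarithm of \<open>l 0\<close> instead of a
        limit.\<close>
      obtain a where a: "l 0 = exp a" using nz exp_Ln by metis
      have "l \<xi> = exp (a + of_real b * \<xi>)" for \<xi>
      proof -
        have "(\<lambda>j. exp (\<alpha> j + of_real (\<beta> j) * 0) * exp (of_real (\<beta> j) * \<xi>)) \<longlonglongrightarrow> l 0 * exp (of_real b * \<xi>)"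
          by (intro tendsto_intros l b)
        then show ?thesis using LIMSEQ_unique[OF l[of \<xi>]] by (simp add: a exp_add)
      qed
      then show "\<exists>a b. b \<ge> 0 \<and> l = (\<lambda>\<xi>. exp (a + of_real b * \<xi>))" using b(1) by blast
    next
      show "\<exists>w s. s \<ge> 1 \<and> exp w = (of_nat k :: complex) \<and> (exp has_field_derivative of_real s) (at w)"
        if "k > 0" for k
      proof (intro exI conjI)
        \<comment> \<open>At a logarithm of k the derivative of exp is k itself, which is real and
          at least 1.\<close>
        show e: "exp (Ln (of_nat k)) = (of_nat k :: complex)" using that by (intro exp_Ln) simp
        show "(exp has_field_derivative of_real (real k)) (at (Ln (of_nat k)))"
          using DERIV_exp[of "Ln (of_nat k :: complex)"] by (simp add: e)
      qed (use that in simp)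
    next
      show "filterlim (\<lambda>n. exp (of_nat n) :: complex) at_infinity sequentially"
      proof (rule filterlim_norm_at_top_imp_at_infinity)
        show "filterlim (\<lambda>n. norm (exp (of_nat n) :: complex)) at_top sequentially"
          using filterlim_compose[OF exp_at_top filterlim_real_sequentially] by simp
      qed
    qed (auto intro!: holomorphic_intros)
  qed
qed

end
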